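(* Let $\mathcal{M}_m$ be a meridian surface in $\mathbb{E}^4_2$ parametrized by $$z(u,v) = f(u)\left(\varphi(v)\cosh v\, e_1 + \varphi(v)\sinh v\, e_3 + \frac{\varphi^2(v)}{2}\,\xi_1 + \xi_2\right) + g(u)\,\xi_1,\quad u\in I,\ v\in J,$$ with the normalization $2\varepsilon f'g'=1$ on $I$, and let $K\neq 0$ be a real constant. Then $\mathcal{M}_m$ has constant non-zero Gauss curvature $K$ if and only if the meridian curve $m$ is given by $$f(u)=\alpha\cosh\left(\sqrt{\varepsilon K}\,u\right)+\beta\sinh\left(\sqrt{\varepsilon K}\,u\right)\quad\text{if }\varepsilon K>0,$$ $$f(u)=\alpha\cos\left(\sqrt{-\varepsilon K}\,u\right)+\beta\sin\left(\sqrt{-\varepsilon K}\,u\right)\quad\text{if }\varepsilon K<0,$$ where $\alpha$ and $\beta$ are constants, and $g(u)$ is defined by $g'(u)=\frac{\varepsilon}{2f'(u)}$.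
   Context: $\mathbb{E}^4_2$ is $\mathbb{R}^4$ with the metric $\langle\cdot,\cdot\rangle$ given by $dx_1^2+dx_2^2-dx_3^2-dx_4^2$, and $e_1,e_2,e_3,e_4$ is a fixed orthonormal basis with $\langle e_1,e_1\rangle=\langle e_2,e_2\rangle=1$, $\langle e_3,e_3\rangle=\langle e_4,e_4\rangle=-1$. Put $\xi_1=\frac{e_2+e_4}{\sqrt2}$, $\xi_2=\frac{-e_2+e_4}{\sqrt2}$, so that $\langle\xi_1,\xi_1\rangle=\langle\xi_2,\xi_2\rangle=0$, $\langle\xi_1,\xi_2\rangle=-1$. Let $I,J\subset\mathbb{R}$ be open intervals, $f,g:I\to\mathbb{R}$ and $\varphi:J\to\mathbb{R}$ smooth with $f>0$. Primes denote derivatives with respect to $u$ and dots denote derivatives of $\varphi$ with respect to $v$. The surface $\mathcal{M}_m$ given by $z(u,v)$ is called a meridian surface; its first fundamental form has coefficients $E=-2f'g'$, $F=0$, $G=f^2(\dot\varphi^2-\varphi^2)$. Only Lorentz surfaces (induced metric of signature $(1,1)$) are considered, so it is assumed that either $\dot\varphi^2-\varphi^2>0$ on $J$ and $f'g'>0$ on $I$ (then put $\varepsilon=1$), or $\dot\varphi^2-\varphi^2<0$ on $J$ and $f'g'<0$ on $I$ (then put $\varepsilon=-1$). The parameter $u$ is normalized so that $2\varepsilon f'g'=1$. The meridian curve $m$ is the curve determined by the functions $f(u),g(u)$; the $u$-lines $v=\mathrm{const}$ of $\mathcal{M}_m$ are its (mutually congruent) copies. The Gauss curvature of $\mathcal{M}_m$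 is $\dfrac{\langle h(X,X),h(Y,Y)\rangle-\langle h(X,Y),h(X,Y)\rangle}{\langle X,X\rangle\langle Y,Y\rangle-\langle X,Y\rangle^2}$ for a tangent frame $X,Y$, where $h$ is the second fundamental form. *)

theory Defs
  imports "HOL-Analysis.Analysis"
begin

definition pseudo_inner :: "real ^ 4 \<Rightarrow> real ^ 4 \<Rightarrow> real" where
  "pseudo_inner x y = x $ 1 * y $ 1 + x $ 2 * y $ 2 - x $ 3 * y $ 3 - x $ 4 * y $ 4"

definition pseudo_orthonormal_basis :: "(4 \<Rightarrow> real ^ 4) \<Rightarrow> bool" where
  "pseudo_orthonormal_basis e \<longleftrightarrow>
     pseudo_inner (e 1) (e 1) = 1 \<and> pseudo_inner (e 2) (e 2) = 1 \<and>
     pseudo_inner (e 3) (e 3) = - 1 \<and> pseudo_inner (e 4) (e 4) = - 1 \<and>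
     (\<forall>i j. i \<noteq> j \<longrightarrow> pseudo_inner (e i) (e j) = 0)"

definition xi1 :: "(4 \<Rightarrow> real ^ 4) \<Rightarrow> real ^ 4" where
  "xi1 e = (1 / sqrt 2) *\<^sub>R (e 2 + e 4)"

definition xi2 :: "(4 \<Rightarrow> real ^ 4) \<Rightarrow> real ^ 4" where
  "xi2 e = (1 / sqrt 2) *\<^sub>R (- e 2 + e 4)"

definition open_interval :: "real set \<Rightarrow> bool" where
  "open_interval I \<longleftrightarrow> open I \<and> is_interval I \<and> I \<noteq> {}"

text \<open>Used for open sets only, where the iterated derivatives at a point of the set
  do not depend on the values of the function outside the set.\<close>
definition smooth_on :: "real set \<Rightarrow> (real \<Rightarrow> real) \<Rightarrow> bool" where
  "smooth_on S f \<longleftrightarrow> (\<forall>n. \<forall>x\<in>S. (deriv ^^ n) f differentiable (at x))"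

text \<open>A parametrized surface is a map \<open>z\<close> from the parameter plane. Its tangent vectors at
  \<open>z p\<close> are represented by the parameter vectors \<open>X\<close> that \<open>dz p\<close> sends to them.\<close>
definition push :: "(real \<times> real \<Rightarrow> real ^ 4) \<Rightarrow> real \<times> real \<Rightarrow> real \<times> real \<Rightarrow> real ^ 4" where
  "push z p X = frechet_derivative z (at p) X"

definition tangent_plane :: "(real \<times> real \<Rightarrow> real ^ 4) \<Rightarrow> real \<times> real \<Rightarrow> (real ^ 4) set" where
  "tangent_plane z p = range (push z p)"

definition first_form ::
    "(real \<times> real \<Rightarrow> real ^ 4) \<Rightarrow> real \<times> real \<Rightarrow> real \<times> real \<Rightarrow> real \<times> real \<Rightarrow> real" where
  "first_form z p X Y = pseudo_inner (push z p X) (push z p Y)"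

definition normal_part :: "(real ^ 4) set \<Rightarrow> real ^ 4 \<Rightarrow> real ^ 4" where
  "normal_part T x = (THE n. (\<forall>t\<in>T. pseudo_inner n t = 0) \<and> x - n \<in> T)"

lemma normal_part_eqI:
  assumes "subspace T"
    and nondegenerate: "\<And>t. t \<in> T \<Longrightarrow> (\<forall>s\<in>T. pseudo_inner t s = 0) \<Longrightarrow> t = 0"
    and "\<And>t. t \<in> T \<Longrightarrow> pseudo_inner n t = 0" and "x - n \<in> T"
  shows "normal_part T x = n"
  unfolding normal_part_def
proof (rule the_equality)
  show "(\<forall>t\<in>T. pseudo_inner n t = 0) \<and> x - n \<in> T"
    using assms by blast
next
  fix m assume m: "(\<forall>t\<in>T. pseudo_inner m t = 0) \<and> x - m \<in> T"
  have "(x - n) - (x - m) \<in> T"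
    using assms(1,4) m subspace_diff by blast
  moreover have "pseudo_inner (m - n) s = pseudo_inner m s - pseudo_inner n s" for s
    by (simp add: pseudo_inner_def algebra_simps)
  ultimately have "m - n = 0"
    using assms(3) m by (intro nondegenerate) auto
  then show "m = n" by simp
qed

text \<open>\<open>h(X,Y)\<close> is the normal part of the ambient derivative in direction \<open>X\<close> of the tangent field
  extending \<open>Y\<close>; here \<open>Y\<close> is extended with constant coefficients in the coordinate frame.\<close>
definition second_form ::
    "(real \<times> real \<Rightarrow> real ^ 4) \<Rightarrow> real \<times> real \<Rightarrow> real \<times> real \<Rightarrow> real \<times> real \<Rightarrow> real ^ 4" where
  "second_form z p X Y =
     normal_part (tangent_plane z p) (frechet_derivative (\<lambda>q. push z q Y) (at p) X)"

definition frame_curvature ::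
    "(real \<times> real \<Rightarrow> real ^ 4) \<Rightarrow> real \<times> real \<Rightarrow> real \<times> real \<Rightarrow> real \<times> real \<Rightarrow> real" where
  "frame_curvature z p X Y =
     (pseudo_inner (second_form z p X X) (second_form z p Y Y)
        - pseudo_inner (second_form z p X Y) (second_form z p X Y))
     / (first_form z p X X * first_form z p Y Y - (first_form z p X Y)\<^sup>2)"

text \<open>Where \<open>dz p\<close> is injective, the linearly independent pairs of parameter vectors are exactly
  the tangent frames.\<close>
definition has_gauss_curvature ::
    "(real \<times> real \<Rightarrow> real ^ 4) \<Rightarrow> real \<times> real \<Rightarrow> real \<Rightarrow> bool" where
  "has_gauss_curvature z p K \<longleftrightarrow>
     (\<forall>X Y. X \<noteq> Y \<longrightarrow> independent {X, Y} \<longrightarrow> frame_curvature z p X Y = K)"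

definition meridian_surface ::
    "(4 \<Rightarrow> real ^ 4) \<Rightarrow> (real \<Rightarrow> real) \<Rightarrow> (real \<Rightarrow> real) \<Rightarrow> (real \<Rightarrow> real) \<Rightarrow> real \<times> real \<Rightarrow> real ^ 4" where
  "meridian_surface e f g \<phi> = (\<lambda>(u, v).
     f u *\<^sub>R ((\<phi> v * cosh v) *\<^sub>R e 1 + (\<phi> v * sinh v) *\<^sub>R e 3
              + ((\<phi> v)\<^sup>2 / 2) *\<^sub>R xi1 e + xi2 e)
     + g u *\<^sub>R xi1 e)"

end

theory Submission
  imports Defs
begin

text \<open>A meridian surface has the form \<open>z(u,v) = f(u) l(v) + g(u) \<xi>\<^sub>1\<close>, where \<open>l\<close> runs on the
  light cone and satisfies \<open>\<langle>l, \<xi>\<^sub>1\<rangle> = - 1\<close>. Differentiating \<open>\<langle>l, l\<rangle> = 0\<close> and \<open>\<langle>l, \<xi>\<^sub>1\<rangle> = - 1\<close>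
  yields every scalar product that occurs in the curvature, in terms of \<open>W = \<langle>l', l'\<rangle>\<close> alone.

  Under the normalization \<open>2 f' g' = \<epsilon>\<close> the parameters are orthogonal with \<open>E = - \<epsilon>\<close> and
  \<open>G = f\<^sup>2 W\<close>. The vector \<open>z\<^sub>u\<^sub>u\<close> is already normal, because \<open>f' g'\<close> is constant, and
  \<open>z\<^sub>u\<^sub>v = (f'/f) z\<^sub>v\<close> is tangent, so the numerator of the curvature in the coordinate frame is
  just \<open>\<langle>z\<^sub>u\<^sub>u, z\<^sub>v\<^sub>v\<rangle> = - f f'' W\<close>. The factor \<open>W\<close> cancels and the Gauss curvature is
  \<open>\<epsilon> f'' / f\<close>, independently of \<open>v\<close> and of \<open>\<phi>\<close>
  (\<open>has_gauss_curvature_light_cone_surface_iff\<close>). In any other frame both numerator and denominator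
  are multiplied by the squared determinant of the change of frame
  (\<open>has_gauss_curvature_orthogonal_iff\<close>).

  Curvature \<open>K\<close> therefore means \<open>f'' = \<epsilon> K f\<close>. This linear equation is solved on an interval by
  exhibiting two expressions in \<open>f\<close> and \<open>f'\<close> with vanishing derivative, which are multiples of
  the coefficients \<open>\<alpha>\<close> and \<open>\<beta>\<close> (\<open>hyperbolic_oscillator_iff\<close>, \<open>trigonometric_oscillator_iff\<close>).
  The formula for \<open>g'\<close> is the normalization itself, since \<open>\<epsilon>\<^sup>2 = 1\<close>.\<close>

section \<open>The neutral scalar product\<close>

lemma bounded_bilinear_pseudo_inner: "bounded_bilinear pseudo_inner"
  unfolding bilinear_conv_bounded_bilinear[symmetric] bilinear_def
  by (auto intro!: linearI simp: pseudo_inner_def algebra_simps)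

lemmas pseudo_inner_bilinear =
  bounded_bilinear.add_left[OF bounded_bilinear_pseudo_inner]
  bounded_bilinear.add_right[OF bounded_bilinear_pseudo_inner]
  bounded_bilinear.diff_left[OF bounded_bilinear_pseudo_inner]
  bounded_bilinear.diff_right[OF bounded_bilinear_pseudo_inner]
  bounded_bilinear.minus_left[OF bounded_bilinear_pseudo_inner]
  bounded_bilinear.minus_right[OF bounded_bilinear_pseudo_inner]
  bounded_bilinear.scaleR_left[OF bounded_bilinear_pseudo_inner]
  bounded_bilinear.scaleR_right[OF bounded_bilinear_pseudo_inner]
  bounded_bilinear.zero_left[OF bounded_bilinear_pseudo_inner]
  bounded_bilinear.zero_right[OF bounded_bilinear_pseudo_inner]

lemma pseudo_inner_commute: "pseudo_inner x y = pseudo_inner y x"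
  by (simp add: pseudo_inner_def mult.commute)

lemma has_real_derivative_pseudo_inner:
  assumes "(x has_vector_derivative x') (at t)" and "(y has_vector_derivative y') (at t)"
  shows "((\<lambda>s. pseudo_inner (x s) (y s)) has_real_derivative
           pseudo_inner (x t) y' + pseudo_inner x' (y t)) (at t)"
  using bounded_bilinear.has_vector_derivative[OF bounded_bilinear_pseudo_inner assms]
  by (simp add: has_real_derivative_iff_has_vector_derivative)

text \<open>Turns identities between scalar products along a curve into identities for its derivatives.\<close>
lemma has_real_derivative_locally_constant:
  assumes "(F has_real_derivative D) (at t)" and "open S" and "t \<in> S"
    and "\<And>s. s \<in> S \<Longrightarrow> F s = c"
  shows "D = 0"
proof -
  have "((\<lambda>_. c) has_real_derivative D) (at t)"
    using assms by (rule has_field_derivative_transform_within_open) auto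
  then show ?thesis using DERIV_unique DERIV_const by blast
qed

text \<open>The Gram-Schmidt remainder. It is orthogonal to \<open>a\<close> and \<open>b\<close> when these are orthogonal
  to each other and neither is a null vector.\<close>
definition orthogonal_part :: "real ^ 4 \<Rightarrow> real ^ 4 \<Rightarrow> real ^ 4 \<Rightarrow> real ^ 4" where
  "orthogonal_part a b x =
     x - (pseudo_inner x a / pseudo_inner a a) *\<^sub>R a - (pseudo_inner x b / pseudo_inner b b) *\<^sub>R b"

lemma orthogonal_part_linear:
  "orthogonal_part a b (x + y) = orthogonal_part a b x + orthogonal_part a b y"
  "orthogonal_part a b (r *\<^sub>R x) = r *\<^sub>R orthogonal_part a b x"
  by (simp_all add: orthogonal_part_def pseudo_inner_bilinear algebra_simps add_divide_distrib)

lemma range_frame_eq_span: "range (\<lambda>X. fst X *\<^sub>R a + snd X *\<^sub>R b) = span {a, b :: real ^ 4}"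
proof (intro equalityI subsetI)
  fix x assume "x \<in> range (\<lambda>X. fst X *\<^sub>R a + snd X *\<^sub>R b)"
  then show "x \<in> span {a, b}"
    by (elim imageE) (simp, intro span_add span_scale span_base; simp)
next
  fix x assume "x \<in> span {a, b}"
  then obtain k l where "x - k *\<^sub>R a - l *\<^sub>R b = 0" by (auto simp: span_breakdown_eq)
  then have "x = fst (k, l) *\<^sub>R a + snd (k, l) *\<^sub>R b" by (simp add: algebra_simps)
  then show "x \<in> range (\<lambda>X. fst X *\<^sub>R a + snd X *\<^sub>R b)" by (rule range_eqI)
qed

text \<open>An orthogonal pair without null vectors spans a nondegenerate plane: a vector \<open>k a + l b\<close> of the
  plane is recovered from its scalar products with \<open>a\<close> and \<open>b\<close>. This is what makes the normal part
  unique although the scalar product is indefinite.\<close>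
lemma normal_part_span_orthogonal:
  assumes orth: "pseudo_inner a b = 0"
    and a: "pseudo_inner a a \<noteq> 0" and b: "pseudo_inner b b \<noteq> 0"
  shows "normal_part (span {a, b}) x = orthogonal_part a b x"
proof (rule normal_part_eqI)
  have orth': "pseudo_inner b a = 0" using orth by (simp add: pseudo_inner_commute)
  have coeffs: "\<exists>k l. t = k *\<^sub>R a + l *\<^sub>R b" if "t \<in> span {a, b}" for t
    using that unfolding range_frame_eq_span[symmetric] by auto
  have mem: "a \<in> span {a, b}" "b \<in> span {a, b}" by (auto intro: span_base)
  show "t = 0" if t: "t \<in> span {a, b}" and 0: "\<forall>s\<in>span {a, b}. pseudo_inner t s = 0" for t
  proof -
    obtain k l where t: "t = k *\<^sub>R a + l *\<^sub>R b" using coeffs[OF t] by blast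
    have "pseudo_inner t a = k * pseudo_inner a a" "pseudo_inner t b = l * pseudo_inner b b"
      using orth orth' by (simp_all add: t pseudo_inner_bilinear)
    then show "t = 0" using 0 mem a b t by auto
  qed
  show "pseudo_inner (orthogonal_part a b x) t = 0" if t: "t \<in> span {a, b}" for t
  proof -
    obtain k l where "t = k *\<^sub>R a + l *\<^sub>R b" using coeffs[OF t] by blast
    then show ?thesis
      using orth orth' a b by (simp add: orthogonal_part_def pseudo_inner_bilinear)
  qed
  show "x - orthogonal_part a b x \<in> span {a, b}"
    by (auto simp: orthogonal_part_def intro!: span_add span_scale mem)
qed simp

section \<open>Gauss curvature in orthogonal parameters\<close>

lemma independent_pair_det:
  fixes X Y :: "real \<times> real"
  assumes "X \<noteq> Y" and "independent {X, Y}"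
  shows "fst X * snd Y - snd X * fst Y \<noteq> 0"
proof
  assume det: "fst X * snd Y - snd X * fst Y = 0"
  have Y0: "Y \<noteq> 0" using assms dependent_zero by auto
  have indep: "X \<notin> span {Y}" using assms by (simp add: independent_insert)
  show False
  proof (cases "fst Y = 0")
    case True
    then have "snd Y \<noteq> 0" using Y0 by (auto simp: prod_eq_iff)
    then have "X = (snd X / snd Y) *\<^sub>R Y" using True det by (auto simp: prod_eq_iff)
    then show False using indep by (metis span_base span_scale singletonI)
  next
    case False
    then have "X = (fst X / fst Y) *\<^sub>R Y" using det by (auto simp: prod_eq_iff field_simps)
    then show False using indep by (metis span_base span_scale singletonI)
  qed
qed

lemma independent_coordinate_pair: "independent {(1, 0), (0, 1) :: real \<times> real}"
proof -
  have "(1, 0) \<notin> span {(0, 1) :: real \<times> real}" by (auto simp: span_breakdown_eq prod_eq_iff)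
  then show ?thesis by (simp add: independent_insert prod_eq_iff)
qed

text \<open>The second fundamental form is a symmetric bilinear form with values in the normal space, and
  its Gram expression on \<open>X, Y\<close> is the one on the coordinate frame times the squared determinant of
  \<open>X, Y\<close>. The Gram determinant of the first fundamental form scales in the same way, so the curvature
  of every frame equals that of the coordinate frame.\<close>
lemma has_gauss_curvature_orthogonal_iff:
  fixes z zu zv :: "real \<times> real \<Rightarrow> real ^ 4"
  assumes U: "open U" "p \<in> U"
    and dz: "\<And>q. q \<in> U \<Longrightarrow> (z has_derivative (\<lambda>X. fst X *\<^sub>R zu q + snd X *\<^sub>R zv q)) (at q)"
    and dzu: "(zu has_derivative (\<lambda>X. fst X *\<^sub>R zuu + snd X *\<^sub>R zuv)) (at p)"
    and dzv: "(zv has_derivative (\<lambda>X. fst X *\<^sub>R zuv + snd X *\<^sub>R zvv)) (at p)"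
    and F: "pseudo_inner (zu p) (zv p) = 0"
    and E: "pseudo_inner (zu p) (zu p) \<noteq> 0" and G: "pseudo_inner (zv p) (zv p) \<noteq> 0"
  defines "N \<equiv> orthogonal_part (zu p) (zv p)"
  shows "has_gauss_curvature z p K \<longleftrightarrow>
     (pseudo_inner (N zuu) (N zvv) - pseudo_inner (N zuv) (N zuv))
       / (pseudo_inner (zu p) (zu p) * pseudo_inner (zv p) (zv p)) = K"
proof -
  let ?E = "pseudo_inner (zu p) (zu p)" and ?G = "pseudo_inner (zv p) (zv p)"
  let ?num = "pseudo_inner (N zuu) (N zvv) - pseudo_inner (N zuv) (N zuv)"
  have push: "push z q X = fst X *\<^sub>R zu q + snd X *\<^sub>R zv q" if "q \<in> U" for q X
    unfolding push_def using frechet_derivative_at[OF dz[OF that], symmetric] by simp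
  have tangent: "tangent_plane z p = span {zu p, zv p}"
    unfolding tangent_plane_def range_frame_eq_span[symmetric] using push[OF U(2)] by auto
  have dpush: "frechet_derivative (\<lambda>q. push z q Y) (at p) X =
      (fst X * fst Y) *\<^sub>R zuu + (fst X * snd Y + snd X * fst Y) *\<^sub>R zuv + (snd X * snd Y) *\<^sub>R zvv"
    for X Y
  proof -
    have "((\<lambda>q. fst Y *\<^sub>R zu q + snd Y *\<^sub>R zv q) has_derivative
        (\<lambda>X. fst Y *\<^sub>R (fst X *\<^sub>R zuu + snd X *\<^sub>R zuv) + snd Y *\<^sub>R (fst X *\<^sub>R zuv + snd X *\<^sub>R zvv)))
        (at p)"
      by (intro derivative_intros dzu dzv)
    then have "((\<lambda>q. push z q Y) has_derivative
        (\<lambda>X. fst Y *\<^sub>R (fst X *\<^sub>R zuu + snd X *\<^sub>R zuv) + snd Y *\<^sub>R (fst X *\<^sub>R zuv + snd X *\<^sub>R zvv)))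
        (at p)"
      by (rule has_derivative_transform_within_open[OF _ U]) (simp add: push)
    from frechet_derivative_at[OF this, symmetric] show ?thesis
      by (simp add: algebra_simps)
  qed
  have h: "second_form z p X Y =
      (fst X * fst Y) *\<^sub>R N zuu + (fst X * snd Y + snd X * fst Y) *\<^sub>R N zuv + (snd X * snd Y) *\<^sub>R N zvv"
    for X Y
    unfolding second_form_def dpush tangent normal_part_span_orthogonal[OF F E G] N_def
    by (simp add: orthogonal_part_linear)
  have I: "first_form z p X Y = fst X * fst Y * ?E + snd X * snd Y * ?G" for X Y
    using F by (simp add: first_form_def push[OF U(2)] pseudo_inner_bilinear
        pseudo_inner_commute[of "zv p" "zu p"])
  have curvature: "frame_curvature z p X Y = ?num / (?E * ?G)"
    if det: "fst X * snd Y - snd X * fst Y \<noteq> 0" for X Y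
  proof -
    let ?d = "fst X * snd Y - snd X * fst Y"
    have "pseudo_inner (second_form z p X X) (second_form z p Y Y)
        - pseudo_inner (second_form z p X Y) (second_form z p X Y) = ?d\<^sup>2 * ?num"
      unfolding h
      by (simp only: pseudo_inner_bilinear real_scaleR_def power2_eq_square ring_distribs mult_ac
          pseudo_inner_commute[of "N zvv" "N zuu"] pseudo_inner_commute[of "N zvv" "N zuv"]
          pseudo_inner_commute[of "N zuv" "N zuu"])
    moreover have "first_form z p X X * first_form z p Y Y - (first_form z p X Y)\<^sup>2
        = ?d\<^sup>2 * (?E * ?G)"
      unfolding I by (simp only: power2_eq_square ring_distribs mult_ac)
    ultimately show ?thesis using det by (simp add: frame_curvature_def)
  qed
  show ?thesis
  proof
    assume "has_gauss_curvature z p K"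
    then have "frame_curvature z p (1, 0) (0, 1) = K"
      using independent_coordinate_pair by (simp add: has_gauss_curvature_def)
    then show "?num / (?E * ?G) = K" using curvature[of "(1, 0)" "(0, 1)"] by simp
  next
    assume "?num / (?E * ?G) = K"
    then show "has_gauss_curvature z p K"
      using curvature independent_pair_det by (auto simp: has_gauss_curvature_def)
  qed
qed

section \<open>Surfaces swept by a curve on the light cone\<close>

lemma has_derivative_scaleR_fst_snd:
  fixes L :: "real \<Rightarrow> 'a::real_normed_vector"
  assumes "(F has_real_derivative F') (at (fst q))"
    and "(L has_vector_derivative L') (at (snd q))"
  shows "((\<lambda>q. F (fst q) *\<^sub>R L (snd q)) has_derivative
           (\<lambda>X. fst X *\<^sub>R (F' *\<^sub>R L (snd q)) + snd X *\<^sub>R (F (fst q) *\<^sub>R L'))) (at q)"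
proof -
  have F: "((\<lambda>q. F (fst q)) has_derivative (\<lambda>X. fst X * F')) (at q)"
    using has_derivative_compose[of fst fst q UNIV F "\<lambda>h. h * F'"] assms(1)
    by (simp add: has_derivative_fst has_field_derivative_def mult.commute[of F'] mult_commute_abs)
  have L: "((\<lambda>q. L (snd q)) has_derivative (\<lambda>X. snd X *\<^sub>R L')) (at q)"
    using has_derivative_compose[of snd snd q UNIV L "\<lambda>h. h *\<^sub>R L'"] assms(2)
    by (simp add: has_derivative_snd has_vector_derivative_def)
  show ?thesis
    using has_derivative_scaleR[OF F L] by (simp add: algebra_simps)
qed

text \<open>Only the relations \<open>\<langle>l, l\<rangle> = 0\<close>, \<open>\<langle>l, n\<rangle> = - 1\<close>, \<open>\<langle>n, n\<rangle> = 0\<close> and their derivatives enter the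
  computation, so the curve on the light cone stays arbitrary here. The curvature obtained is
  \<open>f'' / (c f)\<close>, where \<open>c = 2 f' g'\<close>.\<close>
lemma has_gauss_curvature_light_cone_surface_iff:
  fixes l l' :: "real \<Rightarrow> real ^ 4" and f g f' g' :: "real \<Rightarrow> real"
  assumes I: "open I" "u \<in> I" and J: "open J" "v \<in> J"
    and f: "\<And>s. s \<in> I \<Longrightarrow> (f has_real_derivative f' s) (at s)"
    and g: "\<And>s. s \<in> I \<Longrightarrow> (g has_real_derivative g' s) (at s)"
    and f'': "(f' has_real_derivative f'') (at u)" and g'': "(g' has_real_derivative g'') (at u)"
    and l: "\<And>t. t \<in> J \<Longrightarrow> (l has_vector_derivative l' t) (at t)"
    and l'': "(l' has_vector_derivative l'') (at v)"
    and ll: "\<And>t. t \<in> J \<Longrightarrow> pseudo_inner (l t) (l t) = 0"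
    and ln: "\<And>t. t \<in> J \<Longrightarrow> pseudo_inner (l t) n = - 1"
    and nn: "pseudo_inner n n = 0"
    and W: "pseudo_inner (l' v) (l' v) \<noteq> 0"
    and fu: "f u \<noteq> 0" and c: "c \<noteq> 0" and fg: "\<And>s. s \<in> I \<Longrightarrow> 2 * f' s * g' s = c"
  shows "has_gauss_curvature (\<lambda>q. f (fst q) *\<^sub>R l (snd q) + g (fst q) *\<^sub>R n) (u, v) K
           \<longleftrightarrow> f'' = c * K * f u"
proof -
  have n: "((\<lambda>_. n) has_vector_derivative 0) (at t)" for t :: real
    by (rule has_vector_derivative_const)
  have l'l: "pseudo_inner (l' t) (l t) = 0" if "t \<in> J" for t
    using has_real_derivative_locally_constant[OF
        has_real_derivative_pseudo_inner[OF l[OF that] l[OF that]] J(1) that ll]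
    by (simp add: pseudo_inner_commute[of "l t" "l' t"])
  have l'n: "pseudo_inner (l' t) n = 0" if "t \<in> J" for t
    using has_real_derivative_locally_constant[OF
        has_real_derivative_pseudo_inner[OF l[OF that] n] J(1) that ln]
    by (simp add: pseudo_inner_bilinear)
  have l''l: "pseudo_inner l'' (l v) = - pseudo_inner (l' v) (l' v)"
    using has_real_derivative_locally_constant[OF
        has_real_derivative_pseudo_inner[OF l'' l[OF J(2)]] J l'l] by simp
  have l''n: "pseudo_inner l'' n = 0"
    using has_real_derivative_locally_constant[OF
        has_real_derivative_pseudo_inner[OF l'' n] J l'n] by (simp add: pseudo_inner_bilinear)
  have "((\<lambda>s. 2 * f' s * g' s) has_real_derivative 2 * (f'' * g' u + f' u * g'')) (at u)"
    by (auto intro!: derivative_eq_intros f'' g'')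
  then have fg': "f'' * g' u + f' u * g'' = 0"
    using has_real_derivative_locally_constant[OF _ I fg] by fastforce
  let ?W = "pseudo_inner (l' v) (l' v)"
  define zu where "zu = (\<lambda>q. f' (fst q) *\<^sub>R l (snd q) + g' (fst q) *\<^sub>R n)"
  define zv where "zv = (\<lambda>q. f (fst q) *\<^sub>R l' (snd q))"
  define zuu where "zuu = f'' *\<^sub>R l v + g'' *\<^sub>R n"
  define zuv where "zuv = f' u *\<^sub>R l' v"
  define zvv where "zvv = f u *\<^sub>R l''"
  note products = pseudo_inner_bilinear ll[OF J(2)] ln[OF J(2)] nn l'l[OF J(2)] l'n[OF J(2)]
    l''l l''n pseudo_inner_commute[of n "l v"] pseudo_inner_commute[of "l v" "l' v"]
    pseudo_inner_commute[of n "l' v"] pseudo_inner_commute[of "l v" l''] pseudo_inner_commute[of n l'']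
  have E: "pseudo_inner (zu (u, v)) (zu (u, v)) = - c"
    using fg[OF I(2)] by (simp add: zu_def products)
  have F: "pseudo_inner (zu (u, v)) (zv (u, v)) = 0" by (simp add: zu_def zv_def products)
  have G: "pseudo_inner (zv (u, v)) (zv (u, v)) = (f u)\<^sup>2 * ?W"
    by (simp add: zv_def products power2_eq_square)
  \<comment> \<open>The product with \<open>z\<^sub>u\<close> is \<open>- (f'' g' + f' g'')\<close>, half the derivative of \<open>E = - 2 f' g'\<close>.\<close>
  have zuu_normal: "pseudo_inner zuu (zu (u, v)) = 0" "pseudo_inner zuu (zv (u, v)) = 0"
    using fg' by (simp_all add: zuu_def zu_def zv_def products algebra_simps)
  let ?N = "orthogonal_part (zu (u, v)) (zv (u, v))"
  have "has_gauss_curvature (\<lambda>q. f (fst q) *\<^sub>R l (snd q) + g (fst q) *\<^sub>R n) (u, v) K \<longleftrightarrow>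
      (pseudo_inner (?N zuu) (?N zvv) - pseudo_inner (?N zuv) (?N zuv))
       / (pseudo_inner (zu (u, v)) (zu (u, v)) * pseudo_inner (zv (u, v)) (zv (u, v))) = K"
  proof (rule has_gauss_curvature_orthogonal_iff)
    show "open (I \<times> J)" "(u, v) \<in> I \<times> J" using I J by (auto intro: open_Times)
    show "((\<lambda>q. f (fst q) *\<^sub>R l (snd q) + g (fst q) *\<^sub>R n) has_derivative
        (\<lambda>X. fst X *\<^sub>R zu q + snd X *\<^sub>R zv q)) (at q)" if "q \<in> I \<times> J" for q
    proof -
      have q: "fst q \<in> I" "snd q \<in> J" using that by auto
      show ?thesis
        using has_derivative_add[OF has_derivative_scaleR_fst_snd[OF f[OF q(1)] l[OF q(2)]]
            has_derivative_scaleR_fst_snd[OF g[OF q(1)] n]]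
        by (simp add: zu_def zv_def algebra_simps)
    qed
    show "(zu has_derivative (\<lambda>X. fst X *\<^sub>R zuu + snd X *\<^sub>R zuv)) (at (u, v))"
      using has_derivative_add[OF
          has_derivative_scaleR_fst_snd[of f' f'' "(u, v)" l "l' v"]
          has_derivative_scaleR_fst_snd[of g' g'' "(u, v)" "\<lambda>_. n" 0]] f'' g'' l[OF J(2)] n
      by (simp add: zu_def zuu_def zuv_def algebra_simps)
    show "(zv has_derivative (\<lambda>X. fst X *\<^sub>R zuv + snd X *\<^sub>R zvv)) (at (u, v))"
      using has_derivative_scaleR_fst_snd[of f "f' u" "(u, v)" l' l''] f[OF I(2)] l''
      by (simp add: zv_def zuv_def zvv_def)
  qed (use E F G c W fu in simp_all)
  also have "?N zuu = zuu"
    using zuu_normal by (simp add: orthogonal_part_def)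
  \<comment> \<open>Here \<open>z\<^sub>u\<^sub>v\<close> is the multiple \<open>f'/f\<close> of \<open>z\<^sub>v\<close>.\<close>
  also have "?N zuv = 0"
    using W fu by (simp add: orthogonal_part_def zuv_def zu_def zv_def products)
  also have "pseudo_inner zuu (?N zvv) = - (f u * f'' * ?W)"
    using zuu_normal
    by (simp add: orthogonal_part_def pseudo_inner_bilinear) (simp add: zuu_def zvv_def products)
  finally show ?thesis
    using c W fu by (simp add: E G pseudo_inner_bilinear field_simps power2_eq_square)
qed

section \<open>Meridian surfaces\<close>

definition cone_curve :: "(4 \<Rightarrow> real ^ 4) \<Rightarrow> (real \<Rightarrow> real) \<Rightarrow> real \<Rightarrow> real ^ 4" where
  "cone_curve e \<phi> v = (\<phi> v * cosh v) *\<^sub>R e 1 + (\<phi> v * sinh v) *\<^sub>R e 3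
     + ((\<phi> v)\<^sup>2 / 2) *\<^sub>R xi1 e + xi2 e"

lemma pseudo_inner_null_frame:
  assumes "pseudo_orthonormal_basis e"
  shows "pseudo_inner (e 1) (e 1) = 1" "pseudo_inner (e 3) (e 3) = - 1"
    "pseudo_inner (e 1) (e 3) = 0" "pseudo_inner (e 3) (e 1) = 0"
    "pseudo_inner (e 1) (xi1 e) = 0" "pseudo_inner (xi1 e) (e 1) = 0"
    "pseudo_inner (e 1) (xi2 e) = 0" "pseudo_inner (xi2 e) (e 1) = 0"
    "pseudo_inner (e 3) (xi1 e) = 0" "pseudo_inner (xi1 e) (e 3) = 0"
    "pseudo_inner (e 3) (xi2 e) = 0" "pseudo_inner (xi2 e) (e 3) = 0"
    "pseudo_inner (xi1 e) (xi1 e) = 0" "pseudo_inner (xi2 e) (xi2 e) = 0"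
    "pseudo_inner (xi1 e) (xi2 e) = - 1" "pseudo_inner (xi2 e) (xi1 e) = - 1"
  using assms by (simp_all add: pseudo_orthonormal_basis_def xi1_def xi2_def pseudo_inner_bilinear)

lemma smooth_onD:
  assumes "smooth_on S f" and "x \<in> S"
  shows "(f has_real_derivative deriv f x) (at x)"
    and "(deriv f has_real_derivative deriv (deriv f) x) (at x)"
proof -
  have "(deriv ^^ 0) f differentiable at x" "(deriv ^^ 1) f differentiable at x"
    using assms unfolding smooth_on_def by blast+
  then show "(f has_real_derivative deriv f x) (at x)"
    and "(deriv f has_real_derivative deriv (deriv f) x) (at x)"
    by (simp_all add: DERIV_deriv_iff_real_differentiable)
qed

text \<open>The curve \<open>cone_curve e \<phi>\<close> lies on the light cone because \<open>\<phi>\<^sup>2 cosh\<^sup>2 - \<phi>\<^sup>2 sinh\<^sup>2 = \<phi>\<^sup>2\<close> is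
  compensated by twice the product of \<open>(\<phi>\<^sup>2/2) \<xi>\<^sub>1\<close> with \<open>\<xi>\<^sub>2\<close>, and its velocity has square
  \<open>\<phi>'\<^sup>2 - \<phi>\<^sup>2\<close>, the quantity whose sign is fixed for a Lorentz surface.\<close>
lemma meridian_surface_curvature_iff:
  assumes e: "pseudo_orthonormal_basis e"
    and I: "open I" "u \<in> I" and J: "open J" "v \<in> J"
    and f: "smooth_on I f" and g: "smooth_on I g" and \<phi>: "smooth_on J \<phi>"
    and "f u \<noteq> 0" and W: "(deriv \<phi> v)\<^sup>2 - (\<phi> v)\<^sup>2 \<noteq> 0"
    and "c \<noteq> 0" and "\<And>s. s \<in> I \<Longrightarrow> 2 * deriv f s * deriv g s = c"
  shows "has_gauss_curvature (meridian_surface e f g \<phi>) (u, v) K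
           \<longleftrightarrow> deriv (deriv f) u = c * K * f u"
proof -
  note products = pseudo_inner_bilinear pseudo_inner_null_frame[OF e]
  have cosh_sinh: "(cosh t)\<^sup>2 = 1 + (sinh t)\<^sup>2" for t :: real by (simp add: cosh_square_eq)
  define l' where "l' = (\<lambda>t. (deriv \<phi> t * cosh t + \<phi> t * sinh t) *\<^sub>R e 1
    + (deriv \<phi> t * sinh t + \<phi> t * cosh t) *\<^sub>R e 3 + (\<phi> t * deriv \<phi> t) *\<^sub>R xi1 e)"
  define l'' where "l'' =
    (deriv (deriv \<phi>) v * cosh v + deriv \<phi> v * sinh v + deriv \<phi> v * sinh v + \<phi> v * cosh v) *\<^sub>R e 1
    + (deriv (deriv \<phi>) v * sinh v + deriv \<phi> v * cosh v + deriv \<phi> v * cosh v + \<phi> v * sinh v) *\<^sub>R e 3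
    + ((deriv \<phi> v)\<^sup>2 + \<phi> v * deriv (deriv \<phi>) v) *\<^sub>R xi1 e"
  have "has_gauss_curvature (\<lambda>q. f (fst q) *\<^sub>R cone_curve e \<phi> (snd q) + g (fst q) *\<^sub>R xi1 e) (u, v) K
      \<longleftrightarrow> deriv (deriv f) u = c * K * f u"
  proof (rule has_gauss_curvature_light_cone_surface_iff[where I = I and J = J and l' = l'
        and l'' = l'' and f' = "deriv f" and g' = "deriv g" and g'' = "deriv (deriv g) u"])
    show "(cone_curve e \<phi> has_vector_derivative l' t) (at t)" if "t \<in> J" for t
      unfolding cone_curve_def l'_def
      by (auto intro!: derivative_eq_intros smooth_onD(1)[OF \<phi> that] simp: algebra_simps)
    show "(l' has_vector_derivative l'') (at v)"
      unfolding l'_def l''_def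
      by (auto intro!: derivative_eq_intros smooth_onD[OF \<phi> J(2)]
          simp: vec_eq_iff algebra_simps power2_eq_square)
    show "pseudo_inner (cone_curve e \<phi> t) (cone_curve e \<phi> t) = 0" for t
      using cosh_sinh[of t] unfolding cone_curve_def by (simp add: products) algebra
    show "pseudo_inner (cone_curve e \<phi> t) (xi1 e) = - 1" for t
      by (simp add: cone_curve_def products)
    have "pseudo_inner (l' v) (l' v) = (deriv \<phi> v)\<^sup>2 - (\<phi> v)\<^sup>2"
      using cosh_sinh[of v] unfolding l'_def by (simp add: products) algebra
    then show "pseudo_inner (l' v) (l' v) \<noteq> 0" using W by simp
  qed (use assms smooth_onD in \<open>auto simp: products\<close>)
  moreover have "meridian_surface e f g \<phi> =
      (\<lambda>q. f (fst q) *\<^sub>R cone_curve e \<phi> (snd q) + g (fst q) *\<^sub>R xi1 e)"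
    by (simp add: fun_eq_iff meridian_surface_def cone_curve_def)
  ultimately show ?thesis by simp
qed

section \<open>The equation of the harmonic oscillator\<close>

lemma zero_derivative_interval_constant:
  fixes F :: "real \<Rightarrow> real"
  assumes "is_interval I" and "\<And>x. x \<in> I \<Longrightarrow> (F has_real_derivative 0) (at x)"
  shows "\<exists>c. \<forall>x\<in>I. F x = c"
  using has_field_derivative_zero_constant[of I F] assms
  by (metis has_field_derivative_at_within is_interval_convex)

text \<open>A solution \<open>f = \<alpha> cosh (k x) + \<beta> sinh (k x)\<close> and its derivative determine \<open>\<alpha>\<close> and \<open>\<beta>\<close> by
  linear equations of determinant \<open>k\<close>. Solving them for \<open>k \<alpha>\<close> and \<open>k \<beta>\<close> gives expressions that
  are defined for every \<open>f\<close>, and the differential equation says exactly that they have derivative 0.\<close>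
lemma hyperbolic_oscillator_iff:
  fixes k :: real
  assumes I: "open I" "is_interval I" and f: "smooth_on I f" and k: "k \<noteq> 0"
  shows "(\<forall>x\<in>I. deriv (deriv f) x = k\<^sup>2 * f x) \<longleftrightarrow>
         (\<exists>\<alpha> \<beta>. \<forall>x\<in>I. f x = \<alpha> * cosh (k * x) + \<beta> * sinh (k * x))"
proof
  assume ode: "\<forall>x\<in>I. deriv (deriv f) x = k\<^sup>2 * f x"
  have d: "(f has_real_derivative deriv f x) (at x)"
    "(deriv f has_real_derivative k\<^sup>2 * f x) (at x)" if "x \<in> I" for x
    using smooth_onD[OF f that] ode that by auto
  have "\<exists>c. \<forall>x\<in>I. k * f x * cosh (k * x) - deriv f x * sinh (k * x) = c"
  proof (rule zero_derivative_interval_constant[OF I(2)])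
    show "((\<lambda>x. k * f x * cosh (k * x) - deriv f x * sinh (k * x)) has_real_derivative 0) (at x)"
      if "x \<in> I" for x
      by (auto intro!: derivative_eq_intros d[OF that] simp: algebra_simps power2_eq_square)
  qed
  then obtain \<alpha> where \<alpha>: "\<And>x. x \<in> I \<Longrightarrow> k * f x * cosh (k * x) - deriv f x * sinh (k * x) = \<alpha>"
    by blast
  have "\<exists>c. \<forall>x\<in>I. deriv f x * cosh (k * x) - k * f x * sinh (k * x) = c"
  proof (rule zero_derivative_interval_constant[OF I(2)])
    show "((\<lambda>x. deriv f x * cosh (k * x) - k * f x * sinh (k * x)) has_real_derivative 0) (at x)"
      if "x \<in> I" for x
      by (auto intro!: derivative_eq_intros d[OF that] simp: algebra_simps power2_eq_square)
  qed
  then obtain \<beta> where \<beta>: "\<And>x. x \<in> I \<Longrightarrow> deriv f x * cosh (k * x) - k * f x * sinh (k * x) = \<beta>"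
    by blast
  have "f x = \<alpha> / k * cosh (k * x) + \<beta> / k * sinh (k * x)" if "x \<in> I" for x
  proof -
    have "\<alpha> * cosh (k * x) + \<beta> * sinh (k * x) = (k * f x) * ((cosh (k * x))\<^sup>2 - (sinh (k * x))\<^sup>2)"
      unfolding \<alpha>[OF that, symmetric] \<beta>[OF that, symmetric]
      by (simp only: power2_eq_square ring_distribs mult_ac)
    also have "(cosh (k * x))\<^sup>2 - (sinh (k * x))\<^sup>2 = 1" by (simp add: cosh_square_eq)
    finally have "f x = (\<alpha> * cosh (k * x) + \<beta> * sinh (k * x)) / k" using k by simp
    then show ?thesis by (simp only: add_divide_distrib times_divide_eq_left)
  qed
  then show "\<exists>\<alpha> \<beta>. \<forall>x\<in>I. f x = \<alpha> * cosh (k * x) + \<beta> * sinh (k * x)" by blast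
next
  assume "\<exists>\<alpha> \<beta>. \<forall>x\<in>I. f x = \<alpha> * cosh (k * x) + \<beta> * sinh (k * x)"
  then obtain \<alpha> \<beta> where sol: "\<And>x. x \<in> I \<Longrightarrow> f x = \<alpha> * cosh (k * x) + \<beta> * sinh (k * x)" by blast
  have f': "deriv f x = k * (\<alpha> * sinh (k * x) + \<beta> * cosh (k * x))" if "x \<in> I" for x
  proof (rule DERIV_imp_deriv, rule has_field_derivative_transform_within_open[OF _ I(1) that])
    show "((\<lambda>x. \<alpha> * cosh (k * x) + \<beta> * sinh (k * x)) has_real_derivative
        k * (\<alpha> * sinh (k * x) + \<beta> * cosh (k * x))) (at x)"
      by (auto intro!: derivative_eq_intros simp: algebra_simps)
  qed (simp add: sol)
  show "\<forall>x\<in>I. deriv (deriv f) x = k\<^sup>2 * f x"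
  proof
    fix x assume x: "x \<in> I"
    have "((\<lambda>x. k * (\<alpha> * sinh (k * x) + \<beta> * cosh (k * x))) has_real_derivative k\<^sup>2 * f x) (at x)"
      by (auto intro!: derivative_eq_intros simp: sol[OF x] algebra_simps power2_eq_square)
    then show "deriv (deriv f) x = k\<^sup>2 * f x"
      by (rule DERIV_imp_deriv[OF has_field_derivative_transform_within_open[OF _ I(1) x]])
        (simp add: f')
  qed
qed

text \<open>As in the hyperbolic case; here the coefficients are recovered with \<open>cos\<^sup>2 + sin\<^sup>2 = 1\<close>, and one
  sign in the second conserved expression changes.\<close>
lemma trigonometric_oscillator_iff:
  fixes k :: real
  assumes I: "open I" "is_interval I" and f: "smooth_on I f" and k: "k \<noteq> 0"
  shows "(\<forall>x\<in>I. deriv (deriv f) x = - k\<^sup>2 * f x) \<longleftrightarrow>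
         (\<exists>\<alpha> \<beta>. \<forall>x\<in>I. f x = \<alpha> * cos (k * x) + \<beta> * sin (k * x))"
proof
  assume ode: "\<forall>x\<in>I. deriv (deriv f) x = - k\<^sup>2 * f x"
  have d: "(f has_real_derivative deriv f x) (at x)"
    "(deriv f has_real_derivative - k\<^sup>2 * f x) (at x)" if "x \<in> I" for x
    using smooth_onD[OF f that] ode that by auto
  have "\<exists>c. \<forall>x\<in>I. k * f x * cos (k * x) - deriv f x * sin (k * x) = c"
  proof (rule zero_derivative_interval_constant[OF I(2)])
    show "((\<lambda>x. k * f x * cos (k * x) - deriv f x * sin (k * x)) has_real_derivative 0) (at x)"
      if "x \<in> I" for x
      by (auto intro!: derivative_eq_intros d[OF that] simp: algebra_simps power2_eq_square)
  qed
  then obtain \<alpha> where \<alpha>: "\<And>x. x \<in> I \<Longrightarrow> k * f x * cos (k * x) - deriv f x * sin (k * x) = \<alpha>"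
    by blast
  have "\<exists>c. \<forall>x\<in>I. k * f x * sin (k * x) + deriv f x * cos (k * x) = c"
  proof (rule zero_derivative_interval_constant[OF I(2)])
    show "((\<lambda>x. k * f x * sin (k * x) + deriv f x * cos (k * x)) has_real_derivative 0) (at x)"
      if "x \<in> I" for x
      by (auto intro!: derivative_eq_intros d[OF that] simp: algebra_simps power2_eq_square)
  qed
  then obtain \<beta> where \<beta>: "\<And>x. x \<in> I \<Longrightarrow> k * f x * sin (k * x) + deriv f x * cos (k * x) = \<beta>"
    by blast
  have "f x = \<alpha> / k * cos (k * x) + \<beta> / k * sin (k * x)" if "x \<in> I" for x
  proof -
    have "\<alpha> * cos (k * x) + \<beta> * sin (k * x) = (k * f x) * ((cos (k * x))\<^sup>2 + (sin (k * x))\<^sup>2)"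
      unfolding \<alpha>[OF that, symmetric] \<beta>[OF that, symmetric]
      by (simp only: power2_eq_square ring_distribs mult_ac)
    also have "(cos (k * x))\<^sup>2 + (sin (k * x))\<^sup>2 = 1" by (simp add: sin_cos_squared_add2)
    finally have "f x = (\<alpha> * cos (k * x) + \<beta> * sin (k * x)) / k" using k by simp
    then show ?thesis by (simp only: add_divide_distrib times_divide_eq_left)
  qed
  then show "\<exists>\<alpha> \<beta>. \<forall>x\<in>I. f x = \<alpha> * cos (k * x) + \<beta> * sin (k * x)" by blast
next
  assume "\<exists>\<alpha> \<beta>. \<forall>x\<in>I. f x = \<alpha> * cos (k * x) + \<beta> * sin (k * x)"
  then obtain \<alpha> \<beta> where sol: "\<And>x. x \<in> I \<Longrightarrow> f x = \<alpha> * cos (k * x) + \<beta> * sin (k * x)" by blast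
  have f': "deriv f x = k * (\<beta> * cos (k * x) - \<alpha> * sin (k * x))" if "x \<in> I" for x
  proof (rule DERIV_imp_deriv, rule has_field_derivative_transform_within_open[OF _ I(1) that])
    show "((\<lambda>x. \<alpha> * cos (k * x) + \<beta> * sin (k * x)) has_real_derivative
        k * (\<beta> * cos (k * x) - \<alpha> * sin (k * x))) (at x)"
      by (auto intro!: derivative_eq_intros simp: algebra_simps)
  qed (simp add: sol)
  show "\<forall>x\<in>I. deriv (deriv f) x = - k\<^sup>2 * f x"
  proof
    fix x assume x: "x \<in> I"
    have "((\<lambda>x. k * (\<beta> * cos (k * x) - \<alpha> * sin (k * x))) has_real_derivative - k\<^sup>2 * f x) (at x)"
      by (auto intro!: derivative_eq_intros simp: sol[OF x] algebra_simps power2_eq_square)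
    then show "deriv (deriv f) x = - k\<^sup>2 * f x"
      by (rule DERIV_imp_deriv[OF has_field_derivative_transform_within_open[OF _ I(1) x]])
        (simp add: f')
  qed
qed

section \<open>Meridian surfaces of constant Gauss curvature\<close>

theorem theorem3:
  fixes e :: "4 \<Rightarrow> real ^ 4" and I J :: "real set"
    and f g \<phi> :: "real \<Rightarrow> real" and \<epsilon> K :: real
  assumes "pseudo_orthonormal_basis e"
    and "open_interval I" and "open_interval J"
    and "smooth_on I f" and "smooth_on I g" and "smooth_on J \<phi>"
    and "\<forall>u\<in>I. f u > 0"
    and "(\<epsilon> = 1 \<and> (\<forall>v\<in>J. (deriv \<phi> v)\<^sup>2 - (\<phi> v)\<^sup>2 > 0) \<and> (\<forall>u\<in>I. deriv f u * deriv g u > 0)) \<or>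
         (\<epsilon> = - 1 \<and> (\<forall>v\<in>J. (deriv \<phi> v)\<^sup>2 - (\<phi> v)\<^sup>2 < 0) \<and> (\<forall>u\<in>I. deriv f u * deriv g u < 0))"
    and "\<forall>u\<in>I. 2 * \<epsilon> * deriv f u * deriv g u = 1"
    and "K \<noteq> 0"
  shows "(\<forall>u\<in>I. \<forall>v\<in>J. has_gauss_curvature (meridian_surface e f g \<phi>) (u, v) K) \<longleftrightarrow>
    (\<exists>\<alpha> \<beta>.
       (\<epsilon> * K > 0 \<longrightarrow>
          (\<forall>u\<in>I. f u = \<alpha> * cosh (sqrt (\<epsilon> * K) * u) + \<beta> * sinh (sqrt (\<epsilon> * K) * u))) \<and>
       (\<epsilon> * K < 0 \<longrightarrow>
          (\<forall>u\<in>I. f u = \<alpha> * cos (sqrt (- \<epsilon> * K) * u) + \<beta> * sin (sqrt (- \<epsilon> * K) * u))) \<and>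
       (\<forall>u\<in>I. deriv g u = \<epsilon> / (2 * deriv f u)))"
proof -
  have I: "open I" "is_interval I" and J: "open J" "J \<noteq> {}"
    using assms(2,3) by (auto simp: open_interval_def)
  have \<epsilon>: "\<epsilon> * \<epsilon> = 1" "\<epsilon> \<noteq> 0" using assms(8) by auto
  have fg: "2 * deriv f s * deriv g s = \<epsilon>" if "s \<in> I" for s
    using assms(8,9) that by auto
  have g': "deriv g s = \<epsilon> / (2 * deriv f s)" if "s \<in> I" for s
    using fg[OF that] \<epsilon>(2) by (auto simp: field_simps)
  have "has_gauss_curvature (meridian_surface e f g \<phi>) (u, v) K
      \<longleftrightarrow> deriv (deriv f) u = \<epsilon> * K * f u" if "u \<in> I" "v \<in> J" for u v
  proof (rule meridian_surface_curvature_iff[OF assms(1) I(1) that(1) J(1) that(2) assms(4-6)])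
    show "f u \<noteq> 0" using assms(7) that by auto
    show "(deriv \<phi> v)\<^sup>2 - (\<phi> v)\<^sup>2 \<noteq> 0" using assms(8) that by fastforce
  qed (use \<epsilon> fg in auto)
  then have ode: "(\<forall>u\<in>I. \<forall>v\<in>J. has_gauss_curvature (meridian_surface e f g \<phi>) (u, v) K)
      \<longleftrightarrow> (\<forall>u\<in>I. deriv (deriv f) u = \<epsilon> * K * f u)"
    using J(2) by blast
  have "\<epsilon> * K \<noteq> 0" using \<epsilon>(2) assms(10) by simp
  then consider "\<epsilon> * K > 0" | "\<epsilon> * K < 0" by linarith
  then show ?thesis
  proof cases
    case 1
    then have "(sqrt (\<epsilon> * K))\<^sup>2 = \<epsilon> * K" "sqrt (\<epsilon> * K) \<noteq> 0" "\<not> \<epsilon> * K < 0"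
      using \<epsilon>(2) assms(10) by simp_all
    with 1 show ?thesis
      unfolding ode using hyperbolic_oscillator_iff[OF I assms(4), of "sqrt (\<epsilon> * K)"] g' by metis
  next
    case 2
    then have "- (sqrt (- \<epsilon> * K))\<^sup>2 = \<epsilon> * K" "sqrt (- \<epsilon> * K) \<noteq> 0" "\<not> \<epsilon> * K > 0"
      using \<epsilon>(2) assms(10) by simp_all
    with 2 show ?thesis
      unfolding ode using trigonometric_oscillator_iff[OF I assms(4), of "sqrt (- \<epsilon> * K)"] g' by metis
  qed
qed

end
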